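(* Let $G$ be a graph without isolated vertices. Then $\chi'_{CF}(G)\le 2\lceil\log_2\Delta(G)\rceil+1$.
   Context: All graphs are finite and simple. $\Delta(G)$ denotes the maximum degree of $G$. For a graph $G$ and a vertex $v$, $E_G(v)$ denotes the set of edges of $G$ incident with $v$, and for an edge $uv\in E(G)$ its closed neighborhood is $E_G[uv]:=E_G(u)\cup E_G(v)$ (this contains $uv$ itself). An edge $k$-coloring of $G$ is any assignment of colors from $\{1,\dots,k\}$ to the edges of $G$ (not necessarily proper). It is conflict-free if for every edge $uv\in E(G)$ there is a color that appears on exactly one edge of $E_G[uv]$. The conflict-free chromatic index $\chi'_{CF}(G)$ is the least $k$ such that $G$ has a conflict-free edge $k$-coloring. *)

theory Defs
  imports Complex_Main
begin

text \<open>
  The graph on the vertex set \<open>V\<close> has as its edges the two-element sets in \<open>E\<close>, so there are no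
  loops and no multiple edges. The empty graph is allowed.
\<close>

locale fin_simple_graph =
  fixes V :: "'a set" and E :: "'a set set"
  assumes finite_verts: "finite V"
    and edge_subset: "e \<in> E \<Longrightarrow> e \<subseteq> V"
    and edge_card: "e \<in> E \<Longrightarrow> card e = 2"

definition incident_edges :: "'a set set \<Rightarrow> 'a \<Rightarrow> 'a set set" where
  "incident_edges E v = {e \<in> E. v \<in> e}"

definition closed_edge_nbhd :: "'a set set \<Rightarrow> 'a \<Rightarrow> 'a \<Rightarrow> 'a set set" where
  "closed_edge_nbhd E u v = incident_edges E u \<union> incident_edges E v"

definition degree :: "'a set set \<Rightarrow> 'a \<Rightarrow> nat" where
  "degree E v = card (incident_edges E v)"

text \<open>For finite \<open>V\<close> this is a maximum; it is \<open>0\<close> when \<open>V\<close> is empty.\<close>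

definition max_degree :: "'a set \<Rightarrow> 'a set set \<Rightarrow> nat" where
  "max_degree V E = (SUP v\<in>V. degree E v)"

definition isolated :: "'a set set \<Rightarrow> 'a \<Rightarrow> bool" where
  "isolated E v \<longleftrightarrow> incident_edges E v = {}"

text \<open>The values of a coloring outside \<open>E\<close> are irrelevant. Colorings need not be proper.\<close>

definition edge_coloring :: "'a set set \<Rightarrow> nat \<Rightarrow> ('a set \<Rightarrow> nat) \<Rightarrow> bool" where
  "edge_coloring E k c \<longleftrightarrow> (\<forall>e\<in>E. c e \<in> {1..k})"

definition conflict_free :: "'a set set \<Rightarrow> nat \<Rightarrow> ('a set \<Rightarrow> nat) \<Rightarrow> bool" where
  "conflict_free E k c \<longleftrightarrow>
     (\<forall>u v. {u, v} \<in> E \<longrightarrow> (\<exists>i\<in>{1..k}. \<exists>!e. e \<in> closed_edge_nbhd E u v \<and> c e = i))"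

definition cf_chromatic_index :: "'a set set \<Rightarrow> nat" where
  "cf_chromatic_index E = (LEAST k. \<exists>c. edge_coloring E k c \<and> conflict_free E k c)"

text \<open>
  The minimum is over a nonempty set: coloring the edges with pairwise distinct colors is
  conflict-free.
\<close>

lemma (in fin_simple_graph) ex_conflict_free_coloring:
  "\<exists>k c. edge_coloring E k c \<and> conflict_free E k c"
proof -
  have "E \<subseteq> Pow V" using edge_subset by blast
  then have "finite E" using finite_verts by (metis finite_Pow_iff finite_subset)
  then obtain c where c: "bij_betw c E {1..card E}"
    by (metis ex_bij_betw_finite_nat finite_atLeastAtMost card_atLeastAtMost diff_Suc_1
        finite_same_card_bij)
  have col: "edge_coloring E (card E) c"
    using c by (auto simp: edge_coloring_def dest: bij_betwE)
  have "\<exists>i\<in>{1..card E}. \<exists>!e. e \<in> closed_edge_nbhd E u v \<and> c e = i" if uv: "{u, v} \<in> E" for u v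
  proof (intro bexI ex1I)
    show "{u, v} \<in> closed_edge_nbhd E u v \<and> c {u, v} = c {u, v}"
      using uv by (simp add: closed_edge_nbhd_def incident_edges_def)
    show "c {u, v} \<in> {1..card E}" using uv col by (simp add: edge_coloring_def)
    show "e = {u, v}" if "e \<in> closed_edge_nbhd E u v \<and> c e = c {u, v}" for e
      using that uv c
      by (auto simp: closed_edge_nbhd_def incident_edges_def bij_betw_def dest: inj_onD)
  qed
  then show ?thesis using col unfolding conflict_free_def by blast
qed

end

theory Submission
  imports Defs
begin

text \<open>
  Let \<open>2 ^ m\<close> be the least power of two that is at least the maximum degree \<open>\<Delta>\<close>, with
  \<open>\<Delta> \<ge> 2\<close>. The proof rests on the case of a bipartite graph, where two colors and one
  background color suffice and the unique color near an edge is never the background. If a proper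
  vertex coloring with \<open>2 ^ m\<close> colors were at hand, one could put an edge into the group \<open>i\<close> given
  by the highest binary digit in which the colors of its two ends differ. Each of the \<open>m\<close> groups is
  bipartite (split by that digit), so it can be given two colors of its own, while the background
  color is shared by all groups: \<open>2 * m + 1\<close> colors in total.

  A proper coloring with \<open>2 ^ m\<close> colors need not exist (complete graphs, odd cycles) and otherwise
  requires Brooks' theorem when \<open>\<Delta> = 2 ^ m\<close>. Instead, take any partition of the vertices into
  \<open>2 ^ m\<close> classes that is cheapest when a monochromatic edge costs 2 in an even class and 3 in an odd
  class. Since no vertex has more neighbors than there are classes, moving single vertices shows
  that the monochromatic edges form a matching inside the even classes and that their ends have
  exactly one neighbor in every class; moving two vertices in succession shows a little more
  (\<open>ex_cheapest_partition\<close>). These edges join the group of the last binary digit. Then they hang on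
  one side of a bipartite graph at vertices of degree one, and the two colors can be extended to
  them (\<open>ex_locally_unique\<close>).

  For \<open>\<Delta> \<le> 1\<close> the edges are disjoint and a single color suffices.
\<close>

section \<open>Two colors for an almost bipartite graph\<close>

text \<open>
  Color 0 is the background: it never serves as the unique color. This is what lets several edge
  sets share it.
\<close>

definition locally_unique :: "'a set set \<Rightarrow> ('a set \<Rightarrow> nat) \<Rightarrow> bool" where
  "locally_unique H c \<longleftrightarrow> (\<forall>e. c e \<le> 2) \<and>
     (\<forall>e\<in>H. \<exists>k\<in>{1,2}. \<exists>!x. x \<in> H \<and> x \<inter> e \<noteq> {} \<and> c x = k)"

lemma locally_uniqueE:
  assumes "locally_unique H c" "e \<in> H"
  obtains k where "k \<in> {1, 2}" "\<exists>!x. x \<in> H \<and> x \<inter> e \<noteq> {} \<and> c x = k"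
  using assms(1)[unfolded locally_unique_def, THEN conjunct2, THEN bspec, OF assms(2)]
  by (elim bexE)

text \<open>
  Choose a smallest set \<open>B\<close> on the side outside \<open>A\<close> that dominates the vertices of \<open>A\<close>. By
  minimality each \<open>b \<in> B\<close> has a private neighbor \<open>p b\<close>, adjacent to no other vertex of \<open>B\<close>. Attach
  every vertex \<open>a\<close> of \<open>A\<close> to one neighbor \<open>s a \<in> B\<close>, which yields stars centered in \<open>B\<close>; color the
  private edge of each star 1 and its other edges 2.

  Now look at an edge \<open>{a, b}\<close>. If \<open>b \<in> B\<close>, the only edge of color 1 nearby is \<open>{p b, b}\<close>: another
  one would have to be the private edge of a vertex \<open>b'\<close> with \<open>p b' = a\<close>, but then \<open>a\<close> is adjacent
  to \<open>b\<close> and \<open>b'\<close>. If \<open>b \<notin> B\<close>, the only colored edge nearby is \<open>{a, s a}\<close>.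

  The last two conclusions record the shape of the stars; they control what happens when further
  edges are added.
\<close>

lemma ex_star_coloring:
  fixes S :: "'a set set"
  assumes fin: "finite S"
    and bip: "\<And>e. e \<in> S \<Longrightarrow> \<exists>a b. e = {a, b} \<and> a \<in> A \<and> b \<notin> A"
  obtains c where "locally_unique S c"
    and "\<And>a e. a \<in> A \<Longrightarrow> e \<in> S \<Longrightarrow> a \<in> e \<Longrightarrow> \<exists>!x. x \<in> S \<and> a \<in> x \<and> c x \<noteq> 0"
    and "\<And>b e. b \<notin> A \<Longrightarrow> e \<in> S \<Longrightarrow> b \<in> e \<Longrightarrow> c e \<noteq> 0 \<Longrightarrow> \<exists>!x. x \<in> S \<and> b \<in> x \<and> c x = 1"
proof -
  define X where "X = A \<inter> \<Union>S"
  define dom where "dom B \<longleftrightarrow> B \<subseteq> \<Union>S - A \<and> (\<forall>a\<in>X. \<exists>b\<in>B. {a, b} \<in> S)" for B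
  have "finite e" if "e \<in> S" for e
    using bip[OF that] by auto
  then have finU: "finite (\<Union>S - A)"
    using fin by blast
  have "dom (\<Union>S - A)"
    unfolding dom_def
  proof (intro conjI ballI)
    fix a assume "a \<in> X"
    then obtain e where e: "e \<in> S" "a \<in> e" "a \<in> A"
      by (auto simp: X_def)
    from bip[OF e(1)] obtain a' b where "e = {a', b}" "a' \<in> A" "b \<notin> A"
      by blast
    with e show "\<exists>b\<in>\<Union>S - A. {a, b} \<in> S"
      by auto
  qed simp
  then obtain B where B: "dom B" and least: "\<And>B'. dom B' \<Longrightarrow> card B \<le> card B'"
    using ex_has_least_nat[of dom "\<Union>S - A" card] by blast
  have finB: "finite B" and BA: "B \<inter> A = {}"
    using B finU by (auto simp: dom_def intro: finite_subset)
  \<comment> \<open>Deleting \<open>b\<close> from \<open>B\<close> leaves some vertex undominated; it is a private neighbor of \<open>b\<close>.\<close>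
  have "\<exists>a\<in>A. {a, b} \<in> S \<and> (\<forall>b'\<in>B. {a, b'} \<in> S \<longrightarrow> b' = b)" if b: "b \<in> B" for b
  proof -
    have "\<not> dom (B - {b})"
      using least[of "B - {b}"] card_Diff1_less[OF finB b] by linarith
    then obtain a where a: "a \<in> X" "\<forall>b'\<in>B - {b}. {a, b'} \<notin> S"
      using B by (auto simp: dom_def)
    then obtain b' where "b' \<in> B" "{a, b'} \<in> S"
      using B by (auto simp: dom_def)
    with a have "{a, b} \<in> S" by (cases "b' = b") auto
    with a show ?thesis
      unfolding X_def by blast
  qed
  then obtain p where p: "\<And>b. b \<in> B \<Longrightarrow> p b \<in> A" "\<And>b. b \<in> B \<Longrightarrow> {p b, b} \<in> S"
      "\<And>b b'. b \<in> B \<Longrightarrow> b' \<in> B \<Longrightarrow> {p b, b'} \<in> S \<Longrightarrow> b' = b"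
    by metis
  obtain s where s: "\<And>a. a \<in> X \<Longrightarrow> s a \<in> B" "\<And>a. a \<in> X \<Longrightarrow> {a, s a} \<in> S"
    using B unfolding dom_def by metis
  have pX: "p b \<in> X" if "b \<in> B" for b
    using p(1,2)[OF that] by (auto simp: X_def)
  have sp: "s (p b) = b" if "b \<in> B" for b
    using p(3)[OF that s(1)[OF pX[OF that]] s(2)[OF pX[OF that]]] .
  define c :: "'a set \<Rightarrow> nat" where
    "c e = (if \<exists>b\<in>B. e = {p b, b} then 1 else if \<exists>a\<in>X. e = {a, s a} then 2 else 0)" for e
  have c0: "c e \<noteq> 0 \<longleftrightarrow> (\<exists>a\<in>X. e = {a, s a})" for e
    using pX sp unfolding c_def by (smt (verit) zero_neq_numeral zero_neq_one)
  have c1: "c e = 1 \<longleftrightarrow> (\<exists>b\<in>B. e = {p b, b})" for e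
    by (simp add: c_def)
  have at_A: "x = {a, s a}" if "c x \<noteq> 0" "a \<in> x" "a \<in> A" for x a
  proof -
    obtain a' where a': "a' \<in> X" "x = {a', s a'}"
      using \<open>c x \<noteq> 0\<close> c0 by blast
    then have "a \<noteq> s a'" using s(1) BA \<open>a \<in> A\<close> by blast
    then show ?thesis using a' \<open>a \<in> x\<close> by simp
  qed
  have at_B: "b \<in> B" if "c x \<noteq> 0" "b \<in> x" "b \<notin> A" for x b
  proof -
    obtain a where a: "a \<in> X" "x = {a, s a}"
      using \<open>c x \<noteq> 0\<close> c0 by blast
    then have "b \<noteq> a" using \<open>b \<notin> A\<close> by (auto simp: X_def)
    then show ?thesis using a s(1) \<open>b \<in> x\<close> by simp
  qed
  have one_at_B: "x = {p b, b}" if "c x = 1" "b \<in> x" "b \<notin> A" for x b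
  proof -
    obtain b' where b': "b' \<in> B" "x = {p b', b'}"
      using \<open>c x = 1\<close> c1 by blast
    then have "b \<noteq> p b'" using p(1) \<open>b \<notin> A\<close> by blast
    then show ?thesis using b' \<open>b \<in> x\<close> by simp
  qed
  show thesis
  proof
    show "\<exists>!x. x \<in> S \<and> a \<in> x \<and> c x \<noteq> 0" if "a \<in> A" "e \<in> S" "a \<in> e" for a e
    proof
      have "a \<in> X" using that by (auto simp: X_def)
      then show "{a, s a} \<in> S \<and> a \<in> {a, s a} \<and> c {a, s a} \<noteq> 0"
        using s(2) c0 by auto
    qed (use that at_A in blast)
    show "\<exists>!x. x \<in> S \<and> b \<in> x \<and> c x = 1" if "b \<notin> A" "e \<in> S" "b \<in> e" "c e \<noteq> 0" for b e
    proof
      have "b \<in> B" using that at_B by blast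
      then show "{p b, b} \<in> S \<and> b \<in> {p b, b} \<and> c {p b, b} = 1"
        using p(2) c1 by auto
    qed (use that one_at_B in blast)
    show "locally_unique S c"
      unfolding locally_unique_def
    proof (intro conjI allI ballI)
      show "c e \<le> 2" for e by (simp add: c_def)
      fix e assume eS: "e \<in> S"
      then obtain a b where e: "e = {a, b}" "a \<in> A" "b \<notin> A"
        using bip by blast
      have aX: "a \<in> X" using e eS by (auto simp: X_def)
      show "\<exists>k\<in>{1,2}. \<exists>!x. x \<in> S \<and> x \<inter> e \<noteq> {} \<and> c x = k"
      proof (cases "b \<in> B")
        case True
        have "\<exists>!x. x \<in> S \<and> x \<inter> e \<noteq> {} \<and> c x = 1"
        proof
          show "{p b, b} \<in> S \<and> {p b, b} \<inter> e \<noteq> {} \<and> c {p b, b} = 1"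
            using True p(2) c1 e by auto
          fix x assume x: "x \<in> S \<and> x \<inter> e \<noteq> {} \<and> c x = 1"
          then obtain b' where b': "b' \<in> B" "x = {p b', b'}"
            using c1 by blast
          then consider "b' = b" | "p b' = a"
            using x e p(1) BA by auto
          then show "x = {p b, b}"
            using b' p(3)[OF b'(1) True] eS e(1) by cases auto
        qed
        then show ?thesis by blast
      next
        case False
        have "\<exists>!x. x \<in> S \<and> x \<inter> e \<noteq> {} \<and> c x = c {a, s a}"
        proof
          show "{a, s a} \<in> S \<and> {a, s a} \<inter> e \<noteq> {} \<and> c {a, s a} = c {a, s a}"
            using s(2) aX e by auto
          fix x assume x: "x \<in> S \<and> x \<inter> e \<noteq> {} \<and> c x = c {a, s a}"
          have "c {a, s a} \<noteq> 0" using aX c0 by blast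
          then show "x = {a, s a}"
            using x e False at_A[of x a] at_B[of x b] by auto
        qed
        moreover have "c {a, s a} \<in> {1, 2}"
          using aX c0[of "{a, s a}"] by (auto simp: c_def)
        ultimately show ?thesis by blast
      qed
    qed
  qed
qed

text \<open>
  The edges of \<open>M\<close> are added to a bipartite graph on the side of \<open>A\<close>. The ends of such an edge
  \<open>{u, v}\<close> have degree one in \<open>S\<close>, so their pendant edges \<open>{u, w}\<close> and \<open>{v, w'}\<close> both carry a
  color from the stars. If the two colors differ, \<open>{u, v}\<close> stays in the background and nothing
  changes. If they agree, \<open>{u, v}\<close> gets the other color and becomes its own witness.
  Among the edges of \<open>S\<close> only the two pendant ones see this new color. The condition that \<open>w\<close> has at
  most one further edge saves them: a star whose center has degree at most two cannot use a color
  twice, so the color of \<open>{u, w}\<close> occurs at no other edge nearby.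
\<close>

lemma ex_locally_unique:
  fixes S M :: "'a set set"
  assumes fin: "finite S"
    and bip: "\<And>e. e \<in> S \<Longrightarrow> \<exists>a b. e = {a, b} \<and> a \<in> A \<and> b \<notin> A"
    and M: "\<And>e. e \<in> M \<Longrightarrow> \<exists>u v. e = {u, v} \<and> u \<noteq> v \<and> u \<in> A \<and> v \<in> A"
    and matching: "\<And>e e'. e \<in> M \<Longrightarrow> e' \<in> M \<Longrightarrow> e \<inter> e' \<noteq> {} \<Longrightarrow> e = e'"
    and pendant: "\<And>e u. e \<in> M \<Longrightarrow> u \<in> e \<Longrightarrow> \<exists>w. {x \<in> S. u \<in> x} = {{u, w}} \<and>
                    (\<exists>y. {x \<in> S. w \<in> x} \<subseteq> {{u, w}, y})"
  shows "\<exists>c. locally_unique (S \<union> M) c"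
proof -
  obtain c where c: "locally_unique S c"
    and one: "\<And>a e. a \<in> A \<Longrightarrow> e \<in> S \<Longrightarrow> a \<in> e \<Longrightarrow> \<exists>!x. x \<in> S \<and> a \<in> x \<and> c x \<noteq> 0"
    and star: "\<And>b e. b \<notin> A \<Longrightarrow> e \<in> S \<Longrightarrow> b \<in> e \<Longrightarrow> c e \<noteq> 0 \<Longrightarrow> \<exists>!x. x \<in> S \<and> b \<in> x \<and> c x = 1"
    using ex_star_coloring[OF fin bip] by blast
  have c2: "c e \<le> 2" for e
    using c by (simp add: locally_unique_def)
  define agree where "agree k e \<longleftrightarrow> (\<forall>x\<in>S. x \<inter> e \<noteq> {} \<longrightarrow> c x = k)" for k e
  define c' where "c' e = (if e \<in> S then c e
     else if e \<in> M \<and> agree 1 e then 2 else if e \<in> M \<and> agree 2 e then 1 else 0)" for e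
  have disj: "e \<notin> S" if "e \<in> M" for e
    using M[OF that] bip[of e] by (auto simp: doubleton_eq_iff)
  have cS: "c' x = c x" if "x \<in> S" for x
    using that by (simp add: c'_def)
  have pend: "\<exists>x. {y \<in> S. u \<in> y} = {x} \<and> c x \<in> {1, 2}" if eM: "e \<in> M" "u \<in> e" for e u
  proof -
    have "u \<in> A" using M eM by blast
    obtain w where w: "{y \<in> S. u \<in> y} = {{u, w}}"
      using pendant[OF eM] by blast
    then have "{u, w} \<in> S" by blast
    from one[OF \<open>u \<in> A\<close> this] obtain x where "x \<in> S" "u \<in> x" "c x \<noteq> 0"
      by auto
    moreover from this have "x = {u, w}" using w by blast
    ultimately have "c {u, w} \<noteq> 0" by simp
    then have "c {u, w} \<in> {1, 2}" using c2[of "{u, w}"] by auto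
    with w show ?thesis by blast
  qed
  have uniq_S: "\<exists>k\<in>{1,2}. \<exists>!x. x \<in> S \<union> M \<and> x \<inter> e \<noteq> {} \<and> c' x = k" if eS: "e \<in> S" for e
  proof (cases "\<exists>g\<in>M. g \<inter> e \<noteq> {} \<and> c' g \<noteq> 0")
    case False
    obtain k where k: "k \<in> {1, 2}" and ex: "\<exists>!x. x \<in> S \<and> x \<inter> e \<noteq> {} \<and> c x = k"
      using locally_uniqueE[OF c eS] .
    have "(x \<in> S \<union> M \<and> x \<inter> e \<noteq> {} \<and> c' x = k) = (x \<in> S \<and> x \<inter> e \<noteq> {} \<and> c x = k)" for x
    proof (cases "x \<in> S")
      case False
      have "k \<noteq> 0" using k by auto
      then show ?thesis using False \<open>\<not> (\<exists>g\<in>M. g \<inter> e \<noteq> {} \<and> c' g \<noteq> 0)\<close> by blast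
    qed (simp add: cS)
    then show ?thesis using k ex by (intro bexI[of _ k]) simp_all
  next
    case True
    then obtain g u where g: "g \<in> M" "c' g \<noteq> 0" "u \<in> g" "u \<in> e"
      by blast
    obtain w y where w: "{x \<in> S. u \<in> x} = {{u, w}}" and y: "{x \<in> S. w \<in> x} \<subseteq> {{u, w}, y}"
      using pendant[OF g(1,3)] by blast
    have e: "e = {u, w}" using w eS g(4) by blast
    have uA: "u \<in> A" using M g by blast
    have wA: "w \<notin> A" using bip[OF eS] e uA by (auto simp: doubleton_eq_iff)
    have k: "c e \<in> {1, 2}"
      using pend[OF g(1,3)] w e by auto
    \<comment> \<open>Here \<open>e\<close> is a pendant edge of \<open>g\<close>, and its own color is the witness.\<close>
    have "c e = j" if "agree j g" for j
      using that eS g unfolding agree_def by blast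
    then have g': "c' g \<noteq> c e"
      using g(2) disj[OF g(1)] unfolding c'_def
      by (metis one_eq_numeral_iff semiring_norm(85))
    have uq: "x = e" if x: "x \<in> S \<union> M" "x \<inter> e \<noteq> {}" "c' x = c e" for x
    proof (cases "x \<in> S")
      case True
      show ?thesis
      proof (rule ccontr)
        assume ne: "x \<noteq> e"
        then have wx: "w \<in> x" using True x w e by auto
        have "w \<in> e" "c e \<noteq> 0" using e k by auto
        from star[OF wA eS this] obtain z where z: "z \<in> S" "w \<in> z" "c z = 1"
          and zu: "\<And>z'. z' \<in> S \<Longrightarrow> w \<in> z' \<Longrightarrow> c z' = 1 \<Longrightarrow> z' = z"
          by (elim ex1E) blast
        \<comment> \<open>One of the two edges at \<open>w\<close> has color 1; as they have equal colors, both do.\<close>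
        have "z \<in> {e, x}" using y e ne z True wx eS by blast
        then have "c e = 1" "c x = 1" using z x cS True by auto
        then show False using zu[of e] zu[of x] ne True wx eS e by auto
      qed
    next
      case False
      then have "x \<in> M" using x by blast
      moreover from this have "u \<in> x" using x(2) e wA M by blast
      ultimately have "x = g" using matching g by blast
      then show ?thesis using x g' by simp
    qed
    have "\<exists>!x. x \<in> S \<union> M \<and> x \<inter> e \<noteq> {} \<and> c' x = c e"
    proof (rule ex1I[of _ e])
      show "e \<in> S \<union> M \<and> e \<inter> e \<noteq> {} \<and> c' e = c e"
        using eS cS[OF eS] e by simp
    qed (use uq in blast)
    then show ?thesis by (rule bexI[OF _ k])
  qed
  have uniq_M: "\<exists>k\<in>{1,2}. \<exists>!x. x \<in> S \<union> M \<and> x \<inter> e \<noteq> {} \<and> c' x = k" if eM: "e \<in> M" for e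
  proof -
    obtain u v where e: "e = {u, v}" "u \<noteq> v"
      using M[OF eM] by blast
    obtain x where x: "{z \<in> S. u \<in> z} = {x}" "c x \<in> {1, 2}"
      using pend[OF eM] e by blast
    obtain y where y: "{z \<in> S. v \<in> z} = {y}" "c y \<in> {1, 2}"
      using pend[OF eM] e by blast
    have xy: "x \<in> S" "u \<in> x" "y \<in> S" "v \<in> y" using x(1) y(1) by blast+
    have near: "z \<in> S \<union> M \<and> z \<inter> e \<noteq> {} \<longleftrightarrow> z \<in> {e, x, y}" for z
    proof
      assume "z \<in> S \<union> M \<and> z \<inter> e \<noteq> {}"
      then show "z \<in> {e, x, y}" using x(1) y(1) e(1) matching[OF _ eM] by blast
    next
      assume "z \<in> {e, x, y}"
      then consider "z = e" | "z = x" | "z = y" by blast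
      then show "z \<in> S \<union> M \<and> z \<inter> e \<noteq> {}"
        using xy e(1) eM by cases auto
    qed
    have agree: "agree k e \<longleftrightarrow> c x = k \<and> c y = k" for k
    proof -
      have "z \<in> S \<and> z \<inter> e \<noteq> {} \<longleftrightarrow> z = x \<or> z = y" for z
        using near[of z] disj[OF eM] xy by auto
      then show ?thesis unfolding agree_def by metis
    qed
    have ce: "c' e = (if c x = c y then 3 - c x else 0)"
      using disj[OF eM] eM x(2) y(2) by (auto simp: c'_def agree)
    define r where "r = (if c x = c y then e else x)"
    have "\<exists>!z. z \<in> {e, x, y} \<and> c' z = c' r"
    proof (rule ex1I[of _ r])
      have "c' e \<noteq> c x" using ce x(2) by auto
      then show "z = r" if "z \<in> {e, x, y} \<and> c' z = c' r" for z
        using that cS[OF xy(1)] cS[OF xy(3)] unfolding r_def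
        by (metis insertE singletonD)
    qed (simp add: r_def)
    moreover have "c' r \<in> {1, 2}"
      using ce x(2) cS[OF xy(1)] unfolding r_def by auto
    moreover have "z \<in> S \<union> M \<and> z \<inter> e \<noteq> {} \<and> c' z = k \<longleftrightarrow> z \<in> {e, x, y} \<and> c' z = k" for z k
      using near[of z] by metis
    ultimately show ?thesis by metis
  qed
  have "c' e \<le> 2" for e
    using c2[of e] by (simp add: c'_def)
  then have "locally_unique (S \<union> M) c'"
    unfolding locally_unique_def using uniq_S uniq_M by (metis UnE)
  then show ?thesis by (rule exI[of _ c'])
qed

section \<open>Merging the groups of a partition of the edges\<close>

text \<open>
  Group \<open>i\<close> uses the colors \<open>2 * i + 2\<close> and \<open>2 * i + 3\<close>, and the background of all groups becomes
  color 1. Near an edge of group \<open>i\<close>, the colors of that group only occur on edges of that group, so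
  the witness found inside the group remains unique in the whole graph.
\<close>

lemma conflict_free_of_groups:
  assumes grp: "\<And>e. e \<in> E \<Longrightarrow> grp e < m"
    and ex: "\<And>i. i < m \<Longrightarrow> \<exists>c. locally_unique {e \<in> E. grp e = i} c"
  shows "\<exists>col. edge_coloring E (2 * m + 1) col \<and> conflict_free E (2 * m + 1) col"
proof -
  obtain c where c: "\<And>i. i < m \<Longrightarrow> locally_unique {e \<in> E. grp e = i} (c i)"
    using ex by metis
  define col where "col e = (if c (grp e) e = 0 then 1 else 2 * grp e + 1 + c (grp e) e)" for e
  have c2: "c (grp e) e \<le> 2" if "e \<in> E" for e
    using c[OF grp[OF that]] by (simp add: locally_unique_def)
  have "edge_coloring E (2 * m + 1) col"
    unfolding edge_coloring_def
  proof
    fix e assume e: "e \<in> E"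
    show "col e \<in> {1..2 * m + 1}"
      using grp[OF e] c2[OF e] by (auto simp: col_def)
  qed
  moreover have "conflict_free E (2 * m + 1) col"
    unfolding conflict_free_def
  proof (intro allI impI)
    fix u v assume uv: "{u, v} \<in> E"
    define i where "i = grp {u, v}"
    have i: "i < m" using grp[OF uv] by (simp add: i_def)
    obtain k where k: "k \<in> {1, 2}"
      and ex: "\<exists>!x. x \<in> {e \<in> E. grp e = i} \<and> x \<inter> {u, v} \<noteq> {} \<and> c i x = k"
      using locally_uniqueE[OF c[OF i], of "{u, v}"] uv by (auto simp: i_def)
    have "(x \<in> closed_edge_nbhd E u v \<and> col x = 2 * i + 1 + k) =
        (x \<in> {e \<in> E. grp e = i} \<and> x \<inter> {u, v} \<noteq> {} \<and> c i x = k)" for x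
    proof (cases "x \<in> E")
      case True
      have "(col x = 2 * i + 1 + k) = (grp x = i \<and> c i x = k)"
      proof
        assume eq: "col x = 2 * i + 1 + k"
        then have "2 * grp x + c (grp x) x = 2 * i + k" "c (grp x) x \<in> {1, 2}"
          using k c2[OF True] by (auto simp: col_def split: if_splits)
        then have "grp x = i" using k by auto
        then show "grp x = i \<and> c i x = k" using eq k by (auto simp: col_def split: if_splits)
      qed (use k in \<open>auto simp: col_def\<close>)
      then show ?thesis
        using True by (auto simp: closed_edge_nbhd_def incident_edges_def)
    qed (auto simp: closed_edge_nbhd_def incident_edges_def)
    then have "\<exists>!x. x \<in> closed_edge_nbhd E u v \<and> col x = 2 * i + 1 + k"
      using ex by simp
    moreover have "2 * i + 1 + k \<in> {1..2 * m + 1}" using i k by auto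
    ultimately show "\<exists>i\<in>{1..2 * m + 1}. \<exists>!e. e \<in> closed_edge_nbhd E u v \<and> col e = i"
      by blast
  qed
  ultimately show ?thesis by blast
qed

section \<open>A cheapest partition of the vertices\<close>

text \<open>
  The price of a monochromatic edge in class \<open>j\<close>. Odd classes are dearer, so that a cheapest
  partition leaves its monochromatic edges in even classes. Any other two positive prices in this
  order would serve as well.
\<close>

definition weight :: "nat \<Rightarrow> nat" where
  "weight j = 2 + j mod 2"

text \<open>
  The set \<open>{j. f ` e = {j}}\<close> is a singleton if \<open>e\<close> is monochromatic and empty otherwise.
\<close>

definition edge_cost :: "('a \<Rightarrow> nat) \<Rightarrow> 'a set \<Rightarrow> nat" where
  "edge_cost f e = (\<Sum>j | f ` e = {j}. weight j)"

definition class_degree :: "'a set set \<Rightarrow> ('a \<Rightarrow> nat) \<Rightarrow> 'a \<Rightarrow> nat \<Rightarrow> nat" where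
  "class_degree E f u j = card {x. {u, x} \<in> E \<and> f x = j}"

context fin_simple_graph
begin

lemma finite_edges: "finite E"
proof -
  have "E \<subseteq> Pow V" using edge_subset by blast
  then show ?thesis using finite_verts by (metis finite_Pow_iff finite_subset)
qed

lemma edge_neq: "{u, v} \<in> E \<Longrightarrow> u \<noteq> v"
  using edge_card[of "{u, v}"] by auto

lemma edgeE:
  assumes "e \<in> E" "u \<in> e"
  obtains v where "e = {u, v}"
proof -
  obtain a b where "e = {a, b}"
    using edge_card[OF assms(1)] by (auto simp: card_2_iff)
  then show thesis using that[of a] that[of b] assms(2) by auto
qed

lemma finite_nbrs: "finite {x. {u, x} \<in> E \<and> P x}"
  by (rule finite_subset[OF _ finite_verts]) (use edge_subset in blast)

lemma incident_eq: "incident_edges E u = (\<lambda>x. {u, x}) ` {x. {u, x} \<in> E}"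
proof (intro equalityI subsetI)
  fix e assume e: "e \<in> incident_edges E u"
  then obtain x where "e = {u, x}"
    using edgeE unfolding incident_edges_def by blast
  with e show "e \<in> (\<lambda>x. {u, x}) ` {x. {u, x} \<in> E}"
    by (auto simp: incident_edges_def)
qed (auto simp: incident_edges_def)

lemma inj_pair: "inj_on (\<lambda>x. {u, x}) X"
  by (auto intro!: inj_onI simp: doubleton_eq_iff)

lemma sum_class_degree:
  assumes "\<And>v. f v < t"
  shows "(\<Sum>j<t. class_degree E f u j) = degree E u"
proof -
  have "degree E u = card {x. {u, x} \<in> E}"
    unfolding degree_def incident_eq by (rule card_image[OF inj_pair])
  also have "{x. {u, x} \<in> E} = (\<Union>j<t. {x. {u, x} \<in> E \<and> f x = j})"
    using assms by auto
  also have "card \<dots> = (\<Sum>j<t. class_degree E f u j)"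
    unfolding class_degree_def by (rule card_UN_disjoint) (auto intro: finite_nbrs)
  finally show ?thesis by simp
qed

text \<open>
  Pigeonhole: a vertex with at most \<open>t\<close> neighbors that meets all \<open>t\<close> classes meets each class once.
\<close>

lemma class_degree_eq_1:
  assumes f: "\<And>v. f v < t" and deg: "degree E u \<le> t"
    and pos: "\<And>j. j < t \<Longrightarrow> 1 \<le> class_degree E f u j" and j: "j < t"
  shows "class_degree E f u j = 1"
proof (rule ccontr)
  assume "class_degree E f u j \<noteq> 1"
  then have "1 < class_degree E f u j" using pos[OF j] by simp
  then have "(\<Sum>i<t. 1) < (\<Sum>i<t. class_degree E f u i)"
    using pos j by (intro sum_strict_mono_ex1) auto
  then show False using sum_class_degree[of f t u, OF f] deg by simp
qed

text \<open>
  The first summand does not depend on the class of \<open>u\<close>, so the cost changes under a move of \<open>u\<close> only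
  through the second one. With \<open>j = f u\<close> the left-hand side is the cost of \<open>f\<close> itself.
\<close>

lemma cost_move:
  "sum (edge_cost (f(u := j))) E =
     sum (edge_cost f) {e \<in> E. u \<notin> e} + weight j * class_degree E f u j"
proof -
  have "sum (edge_cost (f(u := j))) E = sum (edge_cost (f(u := j))) {e \<in> E. u \<notin> e} +
      sum (edge_cost (f(u := j))) (incident_edges E u)"
    by (subst sum.union_disjoint[symmetric])
       (auto simp: finite_edges incident_edges_def intro!: sum.cong)
  also have "sum (edge_cost (f(u := j))) {e \<in> E. u \<notin> e} = sum (edge_cost f) {e \<in> E. u \<notin> e}"
  proof (rule sum.cong)
    fix e assume "e \<in> {e \<in> E. u \<notin> e}"
    then have "(f(u := j)) ` e = f ` e" by auto
    then show "edge_cost (f(u := j)) e = edge_cost f e" by (simp add: edge_cost_def)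
  qed simp
  also have "sum (edge_cost (f(u := j))) (incident_edges E u) =
      (\<Sum>x | {u, x} \<in> E. edge_cost (f(u := j)) {u, x})"
    unfolding incident_eq by (subst sum.reindex[OF inj_pair]) simp
  also have "\<dots> = (\<Sum>x | {u, x} \<in> E. if f x = j then weight j else 0)"
  proof (rule sum.cong)
    fix x assume "x \<in> {x. {u, x} \<in> E}"
    then have "x \<noteq> u" using edge_neq by blast
    then have "{i. (f(u := j)) ` {u, x} = {i}} = (if f x = j then {j} else {})" by auto
    then show "edge_cost (f(u := j)) {u, x} = (if f x = j then weight j else 0)"
      by (simp add: edge_cost_def)
  qed simp
  also have "\<dots> = weight j * class_degree E f u j"
    using finite_nbrs[of u "\<lambda>_. True"]
    by (simp add: class_degree_def sum.If_cases Int_def conj_commute)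
  finally show ?thesis .
qed

text \<open>
  Let \<open>u\<close> have a neighbor in its own class in a cheapest partition. As no move of \<open>u\<close> pays off, \<open>u\<close>
  has a neighbor in every class, hence exactly one in each. If the class of \<open>u\<close> were odd, moving \<open>u\<close>
  to class 0 would save 3 and cost 2.

  For the last conclusion, move \<open>u\<close> from its even class to the next class, where its neighbor \<open>w\<close>
  lives. This raises the cost by only 1, and now \<open>w\<close> contributes 3, so moving \<open>w\<close> on to any class
  would bring the cost below the minimum unless \<open>w\<close> has a neighbor there. Hence after the first move \<open>w\<close> has
  exactly one neighbor in each class, which makes two in the class of \<open>u\<close> before it.
\<close>

lemma ex_cheapest_partition:
  assumes deg: "\<And>v. degree E v \<le> t" and t: "0 < t"
  obtains f where "\<And>v. f v < t"
    and "\<And>u v. {u, v} \<in> E \<Longrightarrow> f u = f v \<Longrightarrow> even (f u)"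
    and "\<And>u v j. {u, v} \<in> E \<Longrightarrow> f u = f v \<Longrightarrow> j < t \<Longrightarrow> class_degree E f u j = 1"
    and "\<And>u v w. {u, v} \<in> E \<Longrightarrow> f u = f v \<Longrightarrow> {u, w} \<in> E \<Longrightarrow> f w = f u + 1 \<Longrightarrow>
           class_degree E f w (f u) = 2"
proof -
  define cost where "cost f = sum (edge_cost f) E" for f
  obtain f where f: "\<forall>v. f v < t" and least: "\<And>g. \<forall>v. g v < t \<Longrightarrow> cost f \<le> cost g"
    using ex_has_least_nat[of "\<lambda>f. \<forall>v. f v < t" "\<lambda>_. 0" cost] t by auto
  have move: "weight (f u) * class_degree E f u (f u) \<le> weight j * class_degree E f u j"
    if "j < t" for u j
    using least[of "f(u := j)"] that f cost_move[of f u j] cost_move[of f u "f u"]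
    by (simp add: cost_def)
  have pos: "1 \<le> class_degree E f u (f u)" if "{u, v} \<in> E" "f u = f v" for u v
  proof -
    have "v \<in> {x. {u, x} \<in> E \<and> f x = f u}" using that by simp
    then show ?thesis
      using finite_nbrs[of u "\<lambda>x. f x = f u"] unfolding class_degree_def
      by (metis One_nat_def Suc_leI card_gt_0_iff empty_iff)
  qed
  have one: "class_degree E f u j = 1" if uv: "{u, v} \<in> E" "f u = f v" and j: "j < t" for u v j
  proof (rule class_degree_eq_1[OF _ deg _ j])
    show "1 \<le> class_degree E f u i" if "i < t" for i
      using move[OF that, of u] pos[OF uv]
      by (cases "class_degree E f u i") (auto simp: weight_def)
  qed (use f in auto)
  \<comment> \<open>Both class degrees in \<open>move\<close> are 1, so the weight of the own class is at most that of class 0.\<close>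
  have even: "even (f u)" if uv: "{u, v} \<in> E" "f u = f v" for u v
    using move[of 0 u] one[OF uv, of 0] one[OF uv, of "f u"] f t
    by (auto simp: weight_def mod_2_eq_odd split: if_splits)
  have two: "class_degree E f w (f u) = 2"
    if uv: "{u, v} \<in> E" "f u = f v" and w: "{u, w} \<in> E" "f w = f u + 1" for u v w
  proof -
    define f' where "f' = f(u := f w)"
    have f'_lt: "f' v < t" for v using f by (simp add: f'_def)
    have neq: "u \<noteq> w" using edge_neq[OF w(1)] .
    have wu: "{w, u} \<in> E" using w(1) by (simp add: insert_commute)
    have f'w: "f' w = f w" using neq by (simp add: f'_def)
    have no: "{x. {w, x} \<in> E \<and> f x = f w} = {}"
    proof -
      have "odd (f w)" using even[OF uv] w(2) by simp
      then show ?thesis using even[of w] by force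
    qed
    have "{x. {w, x} \<in> E \<and> f' x = f w} = {u}"
      using no wu by (auto simp: f'_def)
    then have own: "class_degree E f' w (f w) = 1"
      by (simp add: class_degree_def)
    have up: "cost f' = cost f + 1"
    proof -
      have "f w < t" using f by blast
      then show ?thesis
        using cost_move[of f u "f w"] cost_move[of f u "f u"] one[OF uv, of "f w"]
          one[OF uv, of "f u"] f even[OF uv] w(2)
        by (simp add: cost_def f'_def weight_def mod_2_eq_odd)
    qed
    have "class_degree E f' w (f u) = 1"
    proof (rule class_degree_eq_1[OF f'_lt deg])
      fix j assume j: "j < t"
      have "cost f \<le> cost (f'(w := j))"
        using f'_lt j by (intro least) simp
      moreover have "cost (f'(w := j)) + 3 = cost f' + weight j * class_degree E f' w j"
        using cost_move[of f' w j] cost_move[of f' w "f w"] own f'w even[OF uv] w(2)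
          fun_upd_idem[of f' w "f w"]
        by (simp add: cost_def weight_def mod_2_eq_odd)
      ultimately show "1 \<le> class_degree E f' w j"
        using up by (cases "class_degree E f' w j") auto
    qed (use f in blast)
    moreover have "{x. {w, x} \<in> E \<and> f x = f u} = insert u {x. {w, x} \<in> E \<and> f' x = f u}"
      using wu w(2) by (auto simp: f'_def)
    moreover have "u \<notin> {x. {w, x} \<in> E \<and> f' x = f u}"
      using w(2) by (simp add: f'_def)
    ultimately show ?thesis
      using finite_nbrs[of w "\<lambda>x. f' x = f u"] by (simp add: class_degree_def)
  qed
  show thesis
    using that[of f] f even one two by blast
qed

section \<open>Grouping the edges by binary digits\<close>

text \<open>
  The level of an edge is the number of binary digits that must be dropped before the classes of its
  ends agree. Level 0 means monochromatic; at level \<open>i + 1\<close> the digit \<open>i\<close> is the highest one in which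
  the classes differ, so the value of this digit splits the level into two sides. The group of an
  edge is its level minus one, where truncated subtraction puts levels 0 and 1 together: the
  monochromatic edges lie in even classes, that is, on one side of level 1. The neighbors of an end
  \<open>u\<close> at level 1 lie in class \<open>f u + 1\<close>, and there is just one of them.
\<close>

lemma ex_coloring_pow2:
  assumes deg: "\<And>v. degree E v \<le> 2 ^ m" and m: "1 \<le> m"
  shows "\<exists>c. edge_coloring E (2 * m + 1) c \<and> conflict_free E (2 * m + 1) c"
proof -
  obtain f where f: "\<And>v. f v < 2 ^ m"
    and even: "\<And>u v. {u, v} \<in> E \<Longrightarrow> f u = f v \<Longrightarrow> even (f u)"
    and one: "\<And>u v j. {u, v} \<in> E \<Longrightarrow> f u = f v \<Longrightarrow> j < 2 ^ m \<Longrightarrow> class_degree E f u j = 1"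
    and two: "\<And>u v w. {u, v} \<in> E \<Longrightarrow> f u = f v \<Longrightarrow> {u, w} \<in> E \<Longrightarrow> f w = f u + 1 \<Longrightarrow>
           class_degree E f w (f u) = 2"
    by (rule ex_cheapest_partition[of "2 ^ m", OF deg zero_less_power[OF pos2]])
      (rule that, assumption+)
  define same where "same i e \<longleftrightarrow> (\<forall>x\<in>e. \<forall>y\<in>e. f x div 2 ^ i = f y div 2 ^ i)" for i e
  have same_pair: "same i {u, v} \<longleftrightarrow> f u div 2 ^ i = f v div 2 ^ i" for i u v
  proof
    assume "same i {u, v}"
    then show "f u div 2 ^ i = f v div 2 ^ i" unfolding same_def by blast
  qed (simp add: same_def)
  define lev where "lev e = (LEAST i. same i e)" for e
  have same_m: "same m e" for e
    using f by (simp add: same_def)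
  have same_lev: "same (lev e) e" for e
    unfolding lev_def using same_m by (rule LeastI)
  have lev_m: "lev e \<le> m" for e
    unfolding lev_def using same_m by (rule Least_le)
  have not_same: "\<not> same i e" if "i < lev e" for i e
    using that not_less_Least unfolding lev_def by blast
  define S where "S i = {e \<in> E. lev e = Suc i}" for i
  define M where "M = {e \<in> E. lev e = 0}"
  have fin: "finite (S i)" for i
    using finite_edges by (simp add: S_def)
  have parity: "even a \<noteq> even b" if "a div 2 = b div 2" "a \<noteq> b" for a b :: nat
    using that by presburger
  have bip: "\<exists>a b. e = {a, b} \<and> a \<in> {v. even (f v div 2 ^ i)} \<and> b \<notin> {v. even (f v div 2 ^ i)}"
    if e: "e \<in> S i" for i e
  proof -
    have eE: "e \<in> E" using e by (simp add: S_def)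
    then obtain u where "u \<in> e"
      using edge_card by fastforce
    then obtain v where uv: "e = {u, v}"
      using edgeE[OF eE] by blast
    have "same (Suc i) e" "\<not> same i e"
      using same_lev[of e] not_same[of i e] e by (auto simp: S_def)
    have "f u div 2 ^ Suc i = f v div 2 ^ Suc i"
      using \<open>same (Suc i) e\<close> unfolding uv same_pair .
    then have half: "f u div 2 ^ i div 2 = f v div 2 ^ i div 2"
      unfolding power_Suc2 div_mult2_eq .
    have "f u div 2 ^ i \<noteq> f v div 2 ^ i"
      using \<open>\<not> same i e\<close> unfolding uv same_pair .
    with half have "even (f u div 2 ^ i) \<noteq> even (f v div 2 ^ i)"
      by (rule parity)
    then consider "even (f u div 2 ^ i)" "odd (f v div 2 ^ i)"
      | "even (f v div 2 ^ i)" "odd (f u div 2 ^ i)" by blast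
    then show ?thesis
    proof cases
      case 1
      then show ?thesis using uv by (intro exI[of _ u] exI[of _ v]) simp
    next
      case 2
      then show ?thesis using uv by (intro exI[of _ v] exI[of _ u]) (simp add: insert_commute)
    qed
  qed
  have Mf: "e \<in> E \<and> f u = f v" if "e \<in> M" "u \<in> e" "v \<in> e" for e u v
  proof -
    have "same 0 e" using same_lev[of e] that(1) by (simp add: M_def)
    then have "f u div 2 ^ 0 = f v div 2 ^ 0" using that(2,3) unfolding same_def by blast
    then show ?thesis using that(1) by (simp add: M_def)
  qed
  have nbr_eq: "x = y" if uv: "{u, v} \<in> E" "f u = f v" and j: "j < 2 ^ m"
    and x: "{u, x} \<in> E" "f x = j" and y: "{u, y} \<in> E" "f y = j" for u v j x y
  proof -
    obtain z where "{x. {u, x} \<in> E \<and> f x = j} = {z}"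
      using one[OF uv j] unfolding class_degree_def by (rule card_1_singletonE)
    then have "x \<in> {z}" "y \<in> {z}" using x y by blast+
    then show ?thesis by simp
  qed
  have S0: "f x div 2 = f y div 2 \<and> f x \<noteq> f y" if "{x, y} \<in> S 0" for x y
  proof -
    have "lev {x, y} = 1" using that by (simp add: S_def)
    then have "same 1 {x, y}" "\<not> same 0 {x, y}"
      using same_lev[of "{x, y}"] not_same[of 0 "{x, y}"] by simp_all
    then show ?thesis unfolding same_pair by simp
  qed
  have S0I: "{x, y} \<in> S 0" if "{x, y} \<in> E" "f x div 2 = f y div 2" "f x \<noteq> f y" for x y
  proof -
    have "\<not> same 0 {x, y}" "same 1 {x, y}" using that unfolding same_pair by simp_all
    then have "lev {x, y} \<noteq> 0" "lev {x, y} \<le> 1"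
      using same_lev[of "{x, y}"] not_same[of 1 "{x, y}"] by (metis, meson not_less)
    then have "lev {x, y} = 1" by linarith
    then show ?thesis using that(1) by (simp add: S_def)
  qed
  have groups: "\<exists>c. locally_unique {e \<in> E. lev e - 1 = i} c" for i
  proof (cases "i = 0")
    case False
    then have "{e \<in> E. lev e - 1 = i} = S i \<union> {}"
      by (auto simp: S_def)
    then show ?thesis
      using ex_locally_unique[of "S i" "{v. even (f v div 2 ^ i)}" "{}", OF fin bip] by simp
  next
    case True
    have ends: "\<exists>u v. e = {u, v} \<and> u \<noteq> v \<and>
        u \<in> {v. even (f v div 2 ^ 0)} \<and> v \<in> {v. even (f v div 2 ^ 0)}"
      if "e \<in> M" for e
    proof -
      have eE: "e \<in> E" using that by (simp add: M_def)
      then obtain u where "u \<in> e"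
        using edge_card by fastforce
      then obtain v where uv: "e = {u, v}"
        using edgeE[OF eE] by blast
      then have "{u, v} \<in> E" "f u = f v" using Mf[OF that, of u v] by simp_all
      then have "u \<noteq> v" "even (f u)" "even (f v)" using edge_neq even[of u v] by metis+
      then show ?thesis using uv by (intro exI[of _ u] exI[of _ v]) simp
    qed
    have matching: "e = e'" if e: "e \<in> M" "e' \<in> M" "e \<inter> e' \<noteq> {}" for e e'
    proof -
      obtain u where u: "u \<in> e" "u \<in> e'" using e by blast
      obtain v where v: "e = {u, v}"
        using e u edgeE unfolding M_def by blast
      obtain v' where v': "e' = {u, v'}"
        using e u edgeE unfolding M_def by blast
      have uv: "{u, v} \<in> E" "f v = f u"
        using Mf[OF e(1), of v u] unfolding v by simp_all
      have uv': "{u, v'} \<in> E" "f v' = f u"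
        using Mf[OF e(2), of v' u] unfolding v' by simp_all
      have "v = v'"
        by (rule nbr_eq[OF uv(1) uv(2)[symmetric] f uv uv'])
      then show ?thesis using v v' by simp
    qed
    have pendant: "\<exists>w. {x \<in> S 0. u \<in> x} = {{u, w}} \<and> (\<exists>y. {x \<in> S 0. w \<in> x} \<subseteq> {{u, w}, y})"
      if e: "e \<in> M" "u \<in> e" for e u
    proof -
      obtain v where v: "e = {u, v}"
        using e edgeE unfolding M_def by blast
      have uv: "{u, v} \<in> E" "f u = f v"
        using Mf[OF e(1), of u v] unfolding v by simp_all
      have ev: "even (f u)" using even[OF uv] .
      \<comment> \<open>The number of classes is even, so an even class is not the last one.\<close>
      have lt: "f u + 1 < 2 ^ m"
      proof -
        have "even (2 ^ m :: nat)" using m by simp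
        then have "f u + 1 \<noteq> 2 ^ m" using ev by (metis even_plus_one_iff)
        then show ?thesis using f[of u] by linarith
      qed
      have "class_degree E f u (f u + 1) = 1" using one[OF uv lt] .
      then obtain w where w: "{x. {u, x} \<in> E \<and> f x = f u + 1} = {w}"
        unfolding class_degree_def by (rule card_1_singletonE)
      then have uw: "{u, w} \<in> E" "f w = f u + 1" by blast+
      have at_u: "{x \<in> S 0. u \<in> x} = {{u, w}}"
      proof (intro equalityI subsetI)
        fix x assume x: "x \<in> {x \<in> S 0. u \<in> x}"
        then obtain z where z: "x = {u, z}"
          using edgeE unfolding S_def by blast
        have "f u div 2 = f z div 2 \<and> f u \<noteq> f z" using S0[of u z] x z by simp
        then have "f z = f u + 1" using ev by presburger
        moreover have "{u, z} \<in> E" using x z by (simp add: S_def)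
        ultimately have "z \<in> {x. {u, x} \<in> E \<and> f x = f u + 1}" by simp
        then have "z = w" unfolding w by simp
        then show "x \<in> {{u, w}}" using z by simp
      next
        fix x assume "x \<in> {{u, w}}"
        moreover have "f u div 2 = f w div 2" "f u \<noteq> f w" using uw(2) ev by auto
        ultimately show "x \<in> {x \<in> S 0. u \<in> x}" using S0I[OF uw(1)] by simp
      qed
      have "card {x. {w, x} \<in> E \<and> f x = f u} = 2"
        using two[OF uv uw] by (simp add: class_degree_def)
      then obtain a b where ab: "{x. {w, x} \<in> E \<and> f x = f u} = {a, b}"
        by (auto simp: card_2_iff)
      have "u \<in> {x. {w, x} \<in> E \<and> f x = f u}" using uw(1) by (simp add: insert_commute)
      then have "{a, b} = {u, a} \<or> {a, b} = {u, b}" unfolding ab by blast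
      then obtain b' where b': "{x. {w, x} \<in> E \<and> f x = f u} = {u, b'}"
        using ab by metis
      have "{x \<in> S 0. w \<in> x} \<subseteq> {{u, w}, {w, b'}}"
      proof
        fix x assume x: "x \<in> {x \<in> S 0. w \<in> x}"
        then obtain z where z: "x = {w, z}"
          using edgeE unfolding S_def by blast
        have "f w div 2 = f z div 2 \<and> f w \<noteq> f z" using S0[of w z] x z by simp
        then have "f z = f u" using ev uw(2) by presburger
        moreover have "{w, z} \<in> E" using x z by (simp add: S_def)
        ultimately have "z \<in> {x. {w, x} \<in> E \<and> f x = f u}" by simp
        then have "z = u \<or> z = b'" unfolding b' by simp
        then show "x \<in> {{u, w}, {w, b'}}" using z by (auto simp: insert_commute)
      qed
      then show ?thesis using at_u by blast
    qed
    have "\<exists>c. locally_unique (S 0 \<union> M) c"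
      by (rule ex_locally_unique[of "S 0" "{v. even (f v div 2 ^ 0)}" M,
            OF fin bip ends matching pendant])
    moreover have "{e \<in> E. lev e - 1 = i} = S 0 \<union> M"
      using True by (auto simp: S_def M_def)
    ultimately show ?thesis by simp
  qed
  show ?thesis
  proof (rule conflict_free_of_groups[of E "\<lambda>e. lev e - 1" m])
    show "lev e - 1 < m" for e using lev_m[of e] m by linarith
  qed (use groups in blast)
qed

lemma ex_coloring_matching:
  assumes deg: "\<And>v. degree E v \<le> 1"
  shows "\<exists>c. edge_coloring E 1 c \<and> conflict_free E 1 c"
proof (intro exI conjI)
  show "edge_coloring E 1 (\<lambda>_. 1)" by (simp add: edge_coloring_def)
  have uniq: "x = y" if "x \<in> incident_edges E v" "y \<in> incident_edges E v" for x y v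
  proof -
    have "finite (incident_edges E v)"
      using finite_edges by (simp add: incident_edges_def)
    then show ?thesis
      using deg[of v] that by (simp add: degree_def card_le_Suc0_iff_eq)
  qed
  show "conflict_free E 1 (\<lambda>_. 1)"
    unfolding conflict_free_def
  proof (intro allI impI)
    fix u v assume uv: "{u, v} \<in> E"
    have "\<exists>!e. e \<in> closed_edge_nbhd E u v \<and> (1::nat) = 1"
    proof (intro ex1I)
      show "{u, v} \<in> closed_edge_nbhd E u v \<and> (1::nat) = 1"
        using uv by (simp add: closed_edge_nbhd_def incident_edges_def)
      show "x = {u, v}" if "x \<in> closed_edge_nbhd E u v \<and> (1::nat) = 1" for x
        using that uv uniq[of x u "{u, v}"] uniq[of x v "{u, v}"]
        by (auto simp: closed_edge_nbhd_def incident_edges_def)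
    qed
    then show "\<exists>i\<in>{1..1::nat}. \<exists>!e. e \<in> closed_edge_nbhd E u v \<and> 1 = i" by simp
  qed
qed

lemma degree_le_max_degree: "degree E v \<le> max_degree V E"
proof (cases "v \<in> V")
  case True
  then show ?thesis
    unfolding max_degree_def using finite_verts by (intro cSUP_upper) auto
next
  case False
  then have "incident_edges E v = {}"
    using edge_subset by (auto simp: incident_edges_def)
  then show ?thesis by (simp add: degree_def)
qed

end

theorem corollary1p5:
  fixes V :: "'a set" and E :: "'a set set"
  assumes "fin_simple_graph V E"
    and "\<forall>v\<in>V. \<not> isolated E v"
  shows "int (cf_chromatic_index E) \<le> 2 * \<lceil>log 2 (real (max_degree V E))\<rceil> + 1"
proof -
  interpret fin_simple_graph V E by fact
  define D where "D = max_degree V E"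
  have deg: "degree E v \<le> D" for v
    using degree_le_max_degree by (simp add: D_def)
  show ?thesis
  proof (cases "D \<le> 1")
    case True
    then have "degree E v \<le> 1" for v using deg[of v] by linarith
    then have "cf_chromatic_index E \<le> 1"
      unfolding cf_chromatic_index_def by (intro Least_le ex_coloring_matching)
    moreover have "log 2 (real D) = 0"
      using True by (cases D) (auto simp: log_def)
    ultimately show ?thesis by (simp add: D_def)
  next
    case False
    define m where "m = nat \<lceil>log 2 (real D)\<rceil>"
    have "0 < log 2 (real D)" using False by simp
    then have m: "int m = \<lceil>log 2 (real D)\<rceil>" "1 \<le> m"
      by (simp_all add: m_def Suc_le_eq)
    have "log 2 (real D) \<le> real m"
      using m(1) by (metis le_of_int_ceiling of_int_of_nat_eq)
    then have "real D \<le> 2 powr real m"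
      using False by (simp add: log_le_iff)
    then have "real D \<le> real (2 ^ m)" by (simp add: powr_realpow)
    then have "D \<le> 2 ^ m" by (simp only: of_nat_le_iff)
    then have "degree E v \<le> 2 ^ m" for v using deg[of v] by linarith
    then have "cf_chromatic_index E \<le> 2 * m + 1"
      unfolding cf_chromatic_index_def using m(2) by (intro Least_le ex_coloring_pow2)
    then show ?thesis using m(1) by (simp add: D_def)
  qed
qed

end
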